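(* Let $n\ge2$ and $Q_n=\frac{1}{x_0x_1}\bigl(x_0^2+\sum_{i=1}^{n-1}x_i+n+1\bigr)\in\mathbb{F}_2(x_0,\dots,x_{n-1})$. (i) If $n\ge3$ is odd, then for every $m\ge0$, $d_{\max}(Q_n^{(m)})=(-1)^m(-1+2^{1/n})^{\lceil m/2\rceil}$ and $d_{\min}(Q_n^{(m)})=(-1)^m(-1+2^{1/n})^{\lfloor m/2\rfloor}$. (ii) If $n\ge2$ is even, then for every $m\ge0$, $d_{\max}(Q_n^{(m)})=(-1)^m(-1+2^{2/n})^{\lfloor m/2\rfloor}(-1+2^{1/n})^{m-2\lfloor m/2\rfloor}$ and $d_{\min}(Q_n^{(m)})=(-1)^m(-1+2^{2/n})^{\lfloor m/2\rfloor}(1+2^{1/n})^{m-2\lfloor m/2\rfloor}$.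
   Context: Let $(\ )^*$ be the $\mathbb{F}_2$-algebra monomorphism of $\mathbb{F}_2(x_0,\dots,x_{n-1})$ with $x_i^*=x_{i+1}$ for $0\le i<n-1$ and $x_{n-1}^*=x_0^2$; for $g\notin\mathbb{F}_2$ set $f\circ g:=f(g,g^*,\dots,g^{(n-1)*})$ (well defined as $g,\dots,g^{(n-1)*}$ are algebraically independent). $Q_n^{(m)}$ denotes the $m$-fold composite $Q_n\circ\cdots\circ Q_n$, with $Q_n^{(0)}=x_0$. The degree of a term $c\,x_0^{e_0}\cdots x_{n-1}^{e_{n-1}}$ ($c\ne0$) is $e_0+e_12^{1/n}+\cdots+e_{n-1}2^{(n-1)/n}\in\mathbb{R}$. For a nonzero polynomial $f$, $d_{\max}(f)$ and $d_{\min}(f)$ are the maximum and minimum degrees of its terms; for $f=f_1/f_2$, $d_{\max}(f)=d_{\max}(f_1)-d_{\max}(f_2)$ and $d_{\min}(f)=d_{\min}(f_1)-d_{\min}(f_2)$. *)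

theory Defs
  imports
    Complex_Main
    "HOL-Library.Poly_Mapping"
    "HOL-Library.Z2"
    "HOL-Computational_Algebra.Fraction_Field"
begin

text \<open>
  Exponent vectors are finitely supported maps \<open>nat \<Rightarrow>\<^sub>0 nat\<close>, so these types provide the variables
  \<open>x\<^sub>0, x\<^sub>1, \<dots>\<close> uniformly in the number \<open>n\<close> of variables. The ring
  \<open>\<bbbF>\<^sub>2[x\<^sub>0, \<dots>, x\<^sub>n\<^sub>-\<^sub>1]\<close> is the subset \<open>f2_polys n\<close>, and its fraction field consists of the
  quotients of elements of that subset.
\<close>

type_synonym f2_poly = "(nat \<Rightarrow>\<^sub>0 nat) \<Rightarrow>\<^sub>0 bit"
type_synonym f2_rat = "f2_poly fract"

definition f2_polys :: "nat \<Rightarrow> f2_poly set" where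
  "f2_polys n = {p. \<forall>e \<in> Poly_Mapping.keys p. Poly_Mapping.keys e \<subseteq> {..<n}}"

definition ratconst :: "bit \<Rightarrow> f2_rat" where
  "ratconst c = Fract (Poly_Mapping.single 0 c) 1"

definition ratvar :: "nat \<Rightarrow> f2_rat" where
  "ratvar i = Fract (Poly_Mapping.single (Poly_Mapping.single i 1) 1) 1"

definition poly_subst :: "(nat \<Rightarrow> f2_rat) \<Rightarrow> f2_poly \<Rightarrow> f2_rat" where
  "poly_subst a p =
     (\<Sum>e \<in> Poly_Mapping.keys p. ratconst (Poly_Mapping.lookup p e) *
        (\<Prod>i \<in> Poly_Mapping.keys e. a i ^ Poly_Mapping.lookup e i))"

text \<open>
  The value \<open>f (a\<^sub>0, \<dots>, a\<^sub>n\<^sub>-\<^sub>1)\<close> of a rational function \<open>f\<close> in \<open>x\<^sub>0, \<dots>, x\<^sub>n\<^sub>-\<^sub>1\<close>. It does not depend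
  on the chosen quotient, as long as the denominator does not vanish at \<open>a\<close>; if
  \<open>a\<^sub>0, \<dots>, a\<^sub>n\<^sub>-\<^sub>1\<close> are algebraically independent, every quotient is admissible.
\<close>

definition rat_subst :: "nat \<Rightarrow> (nat \<Rightarrow> f2_rat) \<Rightarrow> f2_rat \<Rightarrow> f2_rat" where
  "rat_subst n a f =
     (THE y. \<exists>p \<in> f2_polys n. \<exists>q \<in> f2_polys n.
        f = Fract p q \<and> poly_subst a q \<noteq> 0 \<and> y = poly_subst a p / poly_subst a q)"

definition star :: "nat \<Rightarrow> f2_rat \<Rightarrow> f2_rat" where
  "star n = rat_subst n (\<lambda>i. if i < n - 1 then ratvar (i + 1) else (ratvar 0)\<^sup>2)"

text \<open>Only meaningful for \<open>g\<close> outside \<open>\<bbbF>\<^sub>2\<close>.\<close>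

definition ratcomp :: "nat \<Rightarrow> f2_rat \<Rightarrow> f2_rat \<Rightarrow> f2_rat" where
  "ratcomp n f g = rat_subst n (\<lambda>i. (star n ^^ i) g) f"

definition Qrat :: "nat \<Rightarrow> f2_rat" where
  "Qrat n = 1 / (ratvar 0 * ratvar 1) *
     ((ratvar 0)\<^sup>2 + (\<Sum>i = 1..n - 1. ratvar i) + of_nat n + 1)"

definition Qiter :: "nat \<Rightarrow> nat \<Rightarrow> f2_rat" where
  "Qiter n m = (ratcomp n (Qrat n) ^^ m) (ratvar 0)"

definition term_degree :: "nat \<Rightarrow> (nat \<Rightarrow>\<^sub>0 nat) \<Rightarrow> real" where
  "term_degree n e =
     (\<Sum>i \<in> Poly_Mapping.keys e. real (Poly_Mapping.lookup e i) * 2 powr (real i / real n))"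

definition poly_dmax :: "nat \<Rightarrow> f2_poly \<Rightarrow> real" where
  "poly_dmax n p = Max (term_degree n ` Poly_Mapping.keys p)"

definition poly_dmin :: "nat \<Rightarrow> f2_poly \<Rightarrow> real" where
  "poly_dmin n p = Min (term_degree n ` Poly_Mapping.keys p)"

text \<open>
  For nonzero \<open>f\<close> the differences below do not depend on the chosen quotient.
\<close>

definition dmax :: "nat \<Rightarrow> f2_rat \<Rightarrow> real" where
  "dmax n f =
     (THE d. \<exists>p \<in> f2_polys n. \<exists>q \<in> f2_polys n.
        p \<noteq> 0 \<and> q \<noteq> 0 \<and> f = Fract p q \<and> d = poly_dmax n p - poly_dmax n q)"

definition dmin :: "nat \<Rightarrow> f2_rat \<Rightarrow> real" where
  "dmin n f =
     (THE d. \<exists>p \<in> f2_polys n. \<exists>q \<in> f2_polys n.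
        p \<noteq> 0 \<and> q \<noteq> 0 \<and> f = Fract p q \<and> d = poly_dmin n p - poly_dmin n q)"

end

theory Submission
  imports Defs
begin

text \<open>
  The maximal degree \<open>dmax\<close> and \<open>-dmin\<close> are both degree valuations on the rational functions, and
  with \<open>t = 2 powr (1 / n)\<close> the endomorphism \<open>star\<close> multiplies them by \<open>t\<close>. If \<open>g\<close> has degree
  \<open>D \<noteq> 0\<close> for one of them, the summands \<open>g\<^sup>2\<close> and \<open>(star n ^^ i) g\<close> in the numerator of
  \<open>ratcomp n (Qrat n) g\<close> have the pairwise distinct degrees \<open>2 * D = t ^ n * D\<close> and \<open>t ^ i * D\<close>,
  besides the constant \<open>n + 1\<close>, which vanishes iff \<open>n\<close> is odd. The dominant summand is \<open>g\<^sup>2\<close> for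
  \<open>D > 0\<close>, and for \<open>D < 0\<close> it is \<open>star n g\<close> (\<open>n\<close> odd) or the constant 1 (\<open>n\<close> even). The new degree is
  accordingly \<open>(1 - t) * D\<close>, \<open>- D\<close> or \<open>- (1 + t) * D\<close>; since the signs alternate, two steps
  multiply the degree by \<open>t - 1\<close> or \<open>t\<^sup>2 - 1\<close>.
\<close>

section \<open>Weights of polynomials\<close>

lemma poly_mapping_sum_singles:
  "p = (\<Sum>e \<in> Poly_Mapping.keys p. Poly_Mapping.single e (Poly_Mapping.lookup p e))"
  for p :: "'a \<Rightarrow>\<^sub>0 'b::comm_monoid_add"
proof (rule poly_mapping_eqI)
  fix k
  show "Poly_Mapping.lookup p k = Poly_Mapping.lookup
      (\<Sum>e \<in> Poly_Mapping.keys p. Poly_Mapping.single e (Poly_Mapping.lookup p e)) k"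
    by (simp add: lookup_sum lookup_single when_def in_keys_iff)
qed

text \<open>A polynomial is the finite sum of its terms. This reduces identities that are additive
  in \<open>p\<close>, such as multiplicativity of \<open>poly_subst\<close>, to single
  terms.\<close>

lemma poly_mapping_additive_induct [case_names zero single add]:
  fixes p :: "'a \<Rightarrow>\<^sub>0 'b::comm_monoid_add"
  assumes "P 0" and "\<And>e c. P (Poly_Mapping.single e c)"
    and "\<And>p q. P p \<Longrightarrow> P q \<Longrightarrow> P (p + q)"
  shows "P p"
proof -
  have "P (\<Sum>e \<in> A. Poly_Mapping.single e (Poly_Mapping.lookup p e))" if "finite A" for A
    using that by (induction A rule: finite_induct) (auto intro: assms)
  then show ?thesis
    by (subst poly_mapping_sum_singles) simp
qed

text \<open>For \<open>p = 0\<close> this is the unspecified \<open>Max {}\<close>, hence the side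
  conditions and the alternatives \<open>p = 0\<close> in the lemmas below.\<close>

definition wmax :: "('a \<Rightarrow> real) \<Rightarrow> ('a \<Rightarrow>\<^sub>0 'b::zero) \<Rightarrow> real" where
  "wmax w p = Max (w ` Poly_Mapping.keys p)"

lemma weight_le_wmax: "e \<in> Poly_Mapping.keys p \<Longrightarrow> w e \<le> wmax w p"
  by (simp add: wmax_def)

lemma wmax_attained:
  assumes "p \<noteq> 0"
  obtains e where "e \<in> Poly_Mapping.keys p" "w e = wmax w p"
proof -
  have "w ` Poly_Mapping.keys p \<noteq> {}"
    using assms by (metis image_is_empty poly_mapping_eqI in_keys_iff empty_iff lookup_zero)
  then have "Max (w ` Poly_Mapping.keys p) \<in> w ` Poly_Mapping.keys p"
    by (intro Max_in) auto
  then show ?thesis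
    using that by (auto simp: wmax_def)
qed

lemma wmax_eqI:
  assumes "e \<in> Poly_Mapping.keys p" "w e = d"
    and "\<And>e'. e' \<in> Poly_Mapping.keys p \<Longrightarrow> w e' \<le> d"
  shows "wmax w p = d"
  unfolding wmax_def using assms by (intro Max_eqI) auto

lemma wmax_single: "c \<noteq> 0 \<Longrightarrow> wmax w (Poly_Mapping.single e c) = w e"
  by (simp add: wmax_def)

lemma split_top_part:
  fixes p :: "'a \<Rightarrow>\<^sub>0 'b::comm_ring_1"
  assumes "p \<noteq> 0"
  obtains p1 p2 where "p = p1 + p2" "p1 \<noteq> 0"
    "\<And>e. e \<in> Poly_Mapping.keys p1 \<Longrightarrow> w e = wmax w p"
    "\<And>e. e \<in> Poly_Mapping.keys p2 \<Longrightarrow> w e < wmax w p"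
proof -
  \<comment> \<open>All terms of maximal weight are collected, since several monomials may share
    it.\<close>
  define p1 where "p1 = Poly_Mapping.mapp (\<lambda>e c. if w e = wmax w p then c else 0) p"
  have l1: "Poly_Mapping.lookup p1 e = (if w e = wmax w p then Poly_Mapping.lookup p e else 0)" for e
    by (auto simp: p1_def lookup_mapp when_def in_keys_iff)
  obtain e where "e \<in> Poly_Mapping.keys p" "w e = wmax w p"
    using assms wmax_attained by blast
  then have "Poly_Mapping.lookup p1 e \<noteq> 0"
    by (simp add: l1 in_keys_iff)
  then have "p1 \<noteq> 0"
    by auto
  moreover have "w e = wmax w p" if "e \<in> Poly_Mapping.keys p1" for e
    using that by (auto simp: in_keys_iff l1 split: if_splits)
  moreover have "w e < wmax w p" if "e \<in> Poly_Mapping.keys (p - p1)" for e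
  proof -
    have "w e \<noteq> wmax w p" "e \<in> Poly_Mapping.keys p"
      using that by (auto simp: in_keys_iff lookup_minus l1 split: if_splits)
    then show ?thesis
      using weight_le_wmax[of e p w] by simp
  qed
  ultimately show ?thesis
    using that[of p1 "p - p1"] by simp
qed

lemma keys_multE:
  assumes "e \<in> Poly_Mapping.keys (p * q)"
  obtains a b where "e = a + b" "a \<in> Poly_Mapping.keys p" "b \<in> Poly_Mapping.keys q"
  using assms keys_mult[of p q] by blast

text \<open>The weight need not separate monomials, but the product of the two top-weight parts
  is nonzero because there are no zero divisors.\<close>

lemma wmax_mult:
  fixes p q :: "'a::{ordered_cancel_comm_monoid_add, linorder} \<Rightarrow>\<^sub>0 'b::idom"
  assumes w: "\<And>a b. w (a + b) = w a + w b" and "p \<noteq> 0" "q \<noteq> 0"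
  shows "wmax w (p * q) = wmax w p + wmax w q"
proof -
  obtain p1 p2 where p: "p = p1 + p2" "p1 \<noteq> 0"
    and p1: "\<And>e. e \<in> Poly_Mapping.keys p1 \<Longrightarrow> w e = wmax w p"
    and p2: "\<And>e. e \<in> Poly_Mapping.keys p2 \<Longrightarrow> w e < wmax w p"
    using split_top_part[OF assms(2), where w = w] by metis
  obtain q1 q2 where q: "q = q1 + q2" "q1 \<noteq> 0"
    and q1: "\<And>e. e \<in> Poly_Mapping.keys q1 \<Longrightarrow> w e = wmax w q"
    and q2: "\<And>e. e \<in> Poly_Mapping.keys q2 \<Longrightarrow> w e < wmax w q"
    using split_top_part[OF assms(3), where w = w] by metis
  have "p1 * q1 \<noteq> 0"
    using p q by simp
  then obtain e where e: "e \<in> Poly_Mapping.keys (p1 * q1)"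
    using wmax_attained by blast
  then have we: "w e = wmax w p + wmax w q"
    by (elim keys_multE) (simp add: w p1 q1)
  \<comment> \<open>The monomials of the three other products have weight strictly below
    \<open>w e\<close>, so none of them cancels the term at \<open>e\<close>.\<close>
  have "e \<notin> Poly_Mapping.keys (p1 * q2)"
    using we p1 q2 by (fastforce simp: w elim!: keys_multE)
  moreover have "e \<notin> Poly_Mapping.keys (p2 * q1)"
    using we p2 q1 by (fastforce simp: w elim!: keys_multE)
  moreover have "e \<notin> Poly_Mapping.keys (p2 * q2)"
    using we p2 q2 by (fastforce simp: w elim!: keys_multE)
  moreover have "p * q = p1 * q1 + p1 * q2 + p2 * q1 + p2 * q2"
    by (simp add: p(1) q(1) algebra_simps)
  ultimately have "e \<in> Poly_Mapping.keys (p * q)"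
    using e by (simp add: in_keys_iff lookup_add)
  then show ?thesis
    using we
    by (rule wmax_eqI) (auto simp: w elim!: keys_multE intro!: add_mono weight_le_wmax)
qed

lemma wmax_add_le:
  fixes p q :: "'a \<Rightarrow>\<^sub>0 'b::comm_monoid_add"
  assumes "p + q \<noteq> 0" "p = 0 \<or> wmax w p \<le> d" "q = 0 \<or> wmax w q \<le> d"
  shows "wmax w (p + q) \<le> d"
proof -
  obtain e where e: "e \<in> Poly_Mapping.keys (p + q)" "w e = wmax w (p + q)"
    using assms(1) wmax_attained by blast
  then have "e \<in> Poly_Mapping.keys p \<or> e \<in> Poly_Mapping.keys q"
    using keys_add[of p q] by blast
  then show ?thesis
    using assms(2,3) e(2) weight_le_wmax[of e p w] weight_le_wmax[of e q w] by auto
qed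

text \<open>A heaviest monomial of \<open>p\<close> does not occur in the lighter \<open>q\<close>,
  so its coefficient survives in the sum.\<close>

lemma wmax_add_eq:
  fixes p q :: "'a \<Rightarrow>\<^sub>0 'b::comm_monoid_add"
  assumes "p \<noteq> 0" "q = 0 \<or> wmax w q < wmax w p"
  shows "p + q \<noteq> 0" "wmax w (p + q) = wmax w p"
proof -
  obtain e where e: "e \<in> Poly_Mapping.keys p" "w e = wmax w p"
    using assms(1) wmax_attained by blast
  have "e \<notin> Poly_Mapping.keys q"
    using assms(2) e(2) weight_le_wmax[of e q w] by auto
  then have *: "e \<in> Poly_Mapping.keys (p + q)"
    using e by (simp add: in_keys_iff lookup_add)
  then show "p + q \<noteq> 0"
    by auto
  have "wmax w (p + q) \<le> wmax w p"
    using assms \<open>p + q \<noteq> 0\<close> by (intro wmax_add_le) auto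
  then show "wmax w (p + q) = wmax w p"
    using weight_le_wmax[OF *, of w] e(2) by simp
qed

section \<open>Polynomials in the first n variables\<close>

lemma f2_polys_zero: "0 \<in> f2_polys n"
  by (simp add: f2_polys_def)

lemma f2_polys_one: "1 \<in> f2_polys n"
  by (simp add: f2_polys_def)

lemma f2_polys_var: "i < n \<Longrightarrow> Poly_Mapping.single (Poly_Mapping.single i k) c \<in> f2_polys n"
  by (simp add: f2_polys_def)

lemma f2_polys_add: "p \<in> f2_polys n \<Longrightarrow> q \<in> f2_polys n \<Longrightarrow> p + q \<in> f2_polys n"
  unfolding f2_polys_def using keys_add[of p q] by blast

lemma f2_polys_mult:
  assumes "p \<in> f2_polys n" "q \<in> f2_polys n"
  shows "p * q \<in> f2_polys n"
  unfolding f2_polys_def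
proof safe
  fix e i
  assume "e \<in> Poly_Mapping.keys (p * q)" and i: "i \<in> Poly_Mapping.keys e"
  then obtain a b where "e = a + b" "a \<in> Poly_Mapping.keys p" "b \<in> Poly_Mapping.keys q"
    by (elim keys_multE)
  then show "i < n"
    using assms i keys_add[of a b] unfolding f2_polys_def by blast
qed

lemma f2_polys_sum: "(\<And>i. i \<in> A \<Longrightarrow> p i \<in> f2_polys n) \<Longrightarrow> (\<Sum>i\<in>A. p i) \<in> f2_polys n"
  by (induction A rule: infinite_finite_induct) (auto simp: f2_polys_zero f2_polys_add)

lemma f2_polys_of_nat: "of_nat k \<in> f2_polys n"
  by (induction k) (auto simp: f2_polys_zero f2_polys_one f2_polys_add)

section \<open>Substitution is a ring homomorphism\<close>

lemma ratconst_add: "ratconst (a + b) = ratconst a + ratconst b"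
  by (simp only: ratconst_def single_add) simp

lemma ratconst_mult: "ratconst (a * b) = ratconst a * ratconst b"
  by (simp add: ratconst_def mult_single del: mult_bit_eq_and)

lemma ratconst_zero [simp]: "ratconst 0 = 0"
  by (simp add: ratconst_def Zero_fract_def)

lemma ratconst_one [simp]: "ratconst 1 = 1"
  by (simp add: ratconst_def One_fract_def)

definition monom_subst :: "(nat \<Rightarrow> 'a::comm_semiring_1) \<Rightarrow> (nat \<Rightarrow>\<^sub>0 nat) \<Rightarrow> 'a" where
  "monom_subst a e = (\<Prod>i \<in> Poly_Mapping.keys e. a i ^ Poly_Mapping.lookup e i)"

text \<open>Exponents outside the support contribute the factor 1; a common index set makes products
  of monomials comparable factor by factor.\<close>

lemma monom_subst_superset:
  assumes "finite A" "Poly_Mapping.keys e \<subseteq> A"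
  shows "monom_subst a e = (\<Prod>i \<in> A. a i ^ Poly_Mapping.lookup e i)"
  unfolding monom_subst_def
  by (rule prod.mono_neutral_left) (use assms in \<open>auto simp: in_keys_iff\<close>)

lemma monom_subst_add: "monom_subst a (e + e') = monom_subst a e * monom_subst a e'"
proof -
  let ?A = "Poly_Mapping.keys e \<union> Poly_Mapping.keys e'"
  have "finite ?A" "Poly_Mapping.keys (e + e') \<subseteq> ?A"
    by (simp_all add: keys_add)
  then show ?thesis
    by (simp add: monom_subst_superset[of ?A] lookup_add power_add prod.distrib)
qed

lemma poly_subst_altdef:
  "poly_subst a p =
     (\<Sum>e \<in> Poly_Mapping.keys p. ratconst (Poly_Mapping.lookup p e) * monom_subst a e)"
  by (simp add: poly_subst_def monom_subst_def)

lemma poly_subst_zero [simp]: "poly_subst a 0 = 0"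
  by (simp add: poly_subst_def)

lemma poly_subst_add: "poly_subst a (p + q) = poly_subst a p + poly_subst a q"
  unfolding poly_subst_altdef
  by (rule setsum_keys_plus_distrib)
    (simp_all add: ratconst_add distrib_right del: add_bit_eq_xor)

lemma poly_subst_single:
  "poly_subst a (Poly_Mapping.single e c) = ratconst c * monom_subst a e"
  by (cases "c = 0") (simp_all add: poly_subst_altdef)

lemma poly_subst_one [simp]: "poly_subst a 1 = 1"
  by (simp add: poly_subst_single monom_subst_def flip: single_one)

lemma poly_subst_mult: "poly_subst a (p * q) = poly_subst a p * poly_subst a q"
proof (induction p rule: poly_mapping_additive_induct)
  case (single e c)
  show ?case
    by (induction q rule: poly_mapping_additive_induct)
      (simp_all add: poly_subst_single mult_single ratconst_mult monom_subst_add poly_subst_add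
        distrib_left distrib_right mult_ac del: mult_bit_eq_and)
qed (simp_all add: poly_subst_add distrib_right)

lemma poly_subst_sum: "poly_subst a (\<Sum>i\<in>A. p i) = (\<Sum>i\<in>A. poly_subst a (p i))"
  by (induction A rule: infinite_finite_induct) (auto simp: poly_subst_add)

lemma poly_subst_of_nat: "poly_subst a (of_nat k) = of_nat k"
  by (induction k) (auto simp: poly_subst_add)

text \<open>Two admissible quotients of one function satisfy \<open>p * q' = p' * q\<close>; the
  homomorphism \<open>poly_subst a\<close> carries this over to the values, so the description is
  unique.\<close>

lemma rat_subst_Fract:
  assumes "p \<in> f2_polys n" "q \<in> f2_polys n" and nz: "poly_subst a q \<noteq> 0"
  shows "rat_subst n a (Fract p q) = poly_subst a p / poly_subst a q"
  unfolding rat_subst_def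
proof (rule the_equality)
  fix y
  assume "\<exists>p'\<in>f2_polys n. \<exists>q'\<in>f2_polys n. Fract p q = Fract p' q' \<and>
    poly_subst a q' \<noteq> 0 \<and> y = poly_subst a p' / poly_subst a q'"
  then obtain p' q' where eq: "Fract p q = Fract p' q'"
    and nz': "poly_subst a q' \<noteq> 0" and y: "y = poly_subst a p' / poly_subst a q'"
    by blast
  \<comment> \<open>Cross-multiplying needs nonzero denominators; they are nonzero because
    \<open>poly_subst a 0 = 0\<close>.\<close>
  have "q \<noteq> 0" "q' \<noteq> 0"
    using nz nz' by auto
  then have "p * q' = p' * q"
    using eq by (simp add: eq_fract)
  then have "poly_subst a p * poly_subst a q' = poly_subst a p' * poly_subst a q"
    by (metis poly_subst_mult)
  then show "y = poly_subst a p / poly_subst a q"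
    using nz nz' unfolding y by (simp add: frac_eq_eq)
qed (use assms in blast)

section \<open>The endomorphism star\<close>

text \<open>The endomorphism sends monomials to monomials: on exponents it is a cyclic shift that
  doubles the entry wrapping around from \<open>n - 1\<close> to 0.\<close>

definition exp_star :: "nat \<Rightarrow> (nat \<Rightarrow>\<^sub>0 nat) \<Rightarrow> (nat \<Rightarrow>\<^sub>0 nat)" where
  "exp_star n e = (\<Sum>i<n. if i < n - 1 then Poly_Mapping.single (i + 1) (Poly_Mapping.lookup e i)
     else Poly_Mapping.single 0 (2 * Poly_Mapping.lookup e i))"

lemma lookup_exp_star:
  assumes "n \<ge> 2"
  shows "Poly_Mapping.lookup (exp_star n e) j =
    (if j = 0 then 2 * Poly_Mapping.lookup e (n - 1)
     else if j < n then Poly_Mapping.lookup e (j - 1) else 0)"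
proof -
  \<comment> \<open>Position \<open>j\<close> is reached from one index only: \<open>n - 1\<close>
    if \<open>j = 0\<close>, else \<open>j - 1\<close>. For \<open>j \<ge> n\<close> the selected
    value is 0.\<close>
  have "Poly_Mapping.lookup (exp_star n e) j =
      (\<Sum>i<n. if i = (if j = 0 then n - 1 else j - 1) then
        (if j = 0 then 2 * Poly_Mapping.lookup e (n - 1)
         else if j < n then Poly_Mapping.lookup e (j - 1) else 0) else 0)"
    unfolding exp_star_def lookup_sum
    by (rule sum.cong) (use assms in \<open>auto simp: lookup_single when_def\<close>)
  also have "\<dots> = (if j = 0 then 2 * Poly_Mapping.lookup e (n - 1)
     else if j < n then Poly_Mapping.lookup e (j - 1) else 0)"
    using assms by (simp only: sum.delta finite_lessThan) auto
  finally show ?thesis .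
qed

text \<open>The last exponent is recovered from its double at position 0, the others from one
  position higher. Exponents at indices from \<open>n\<close> on are forgotten, hence the
  restriction.\<close>

lemma inj_on_exp_star:
  assumes "n \<ge> 2"
  shows "inj_on (exp_star n) {e. Poly_Mapping.keys e \<subseteq> {..<n}}"
proof (rule inj_onI, rule poly_mapping_eqI)
  fix e e' i
  assume e: "e \<in> {e. Poly_Mapping.keys e \<subseteq> {..<n}}" "e' \<in> {e. Poly_Mapping.keys e \<subseteq> {..<n}}"
    and eq: "exp_star n e = exp_star n e'"
  consider "i < n - 1" | "i = n - 1" | "i \<ge> n"
    by linarith
  then show "Poly_Mapping.lookup e i = Poly_Mapping.lookup e' i"
  proof cases
    case 1
    then show ?thesis
      using arg_cong[OF eq, of "\<lambda>e. Poly_Mapping.lookup e (i + 1)"] assms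
      by (simp add: lookup_exp_star split: if_splits)
  next
    case 2
    then show ?thesis
      using arg_cong[OF eq, of "\<lambda>e. Poly_Mapping.lookup e 0"] assms
      by (simp add: lookup_exp_star)
  next
    case 3
    then have "i \<notin> Poly_Mapping.keys e" "i \<notin> Poly_Mapping.keys e'"
      using e by auto
    then show ?thesis
      by (simp add: in_keys_iff)
  qed
qed

lemma keys_exp_star: "n \<ge> 2 \<Longrightarrow> Poly_Mapping.keys (exp_star n e) \<subseteq> {..<n}"
  by (auto simp: in_keys_iff lookup_exp_star split: if_splits)

definition poly_star :: "nat \<Rightarrow> f2_poly \<Rightarrow> f2_poly" where
  "poly_star n p =
     (\<Sum>e \<in> Poly_Mapping.keys p. Poly_Mapping.single (exp_star n e) (Poly_Mapping.lookup p e))"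

text \<open>Injectivity of \<open>h\<close> keeps distinct terms from merging, so no coefficient
  cancels.\<close>

lemma keys_sum_single_inj:
  fixes p :: "'a \<Rightarrow>\<^sub>0 'b::comm_monoid_add"
  assumes "inj_on h (Poly_Mapping.keys p)"
  shows "Poly_Mapping.keys
      (\<Sum>e \<in> Poly_Mapping.keys p. Poly_Mapping.single (h e) (Poly_Mapping.lookup p e)) =
    h ` Poly_Mapping.keys p" (is "Poly_Mapping.keys ?q = _")
proof (intro equalityI subsetI)
  fix k
  assume "k \<in> Poly_Mapping.keys ?q"
  then have "(\<Sum>e \<in> Poly_Mapping.keys p.
      Poly_Mapping.lookup (Poly_Mapping.single (h e) (Poly_Mapping.lookup p e)) k) \<noteq> 0"
    by (simp add: in_keys_iff lookup_sum)
  then obtain e where "e \<in> Poly_Mapping.keys p"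
      "Poly_Mapping.lookup (Poly_Mapping.single (h e) (Poly_Mapping.lookup p e)) k \<noteq> 0"
    by (meson sum.not_neutral_contains_not_neutral)
  then show "k \<in> h ` Poly_Mapping.keys p"
    by (auto simp: lookup_single when_def split: if_splits)
next
  fix k
  assume "k \<in> h ` Poly_Mapping.keys p"
  then obtain a where a: "a \<in> Poly_Mapping.keys p" "k = h a"
    by blast
  have "Poly_Mapping.lookup ?q k =
      (\<Sum>e \<in> Poly_Mapping.keys p. if e = a then Poly_Mapping.lookup p e else 0)"
    unfolding lookup_sum
    by (rule sum.cong) (use a inj_onD[OF assms] in \<open>auto simp: lookup_single when_def\<close>)
  also have "\<dots> = Poly_Mapping.lookup p a"
    using a by simp
  finally show "k \<in> Poly_Mapping.keys ?q"
    using a by (simp add: in_keys_iff)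
qed

lemma keys_poly_star:
  assumes "n \<ge> 2" "p \<in> f2_polys n"
  shows "Poly_Mapping.keys (poly_star n p) = exp_star n ` Poly_Mapping.keys p"
  unfolding poly_star_def
  by (rule keys_sum_single_inj, rule inj_on_subset[OF inj_on_exp_star[OF assms(1)]])
    (use assms in \<open>auto simp: f2_polys_def\<close>)

lemma poly_star_in_f2_polys:
  assumes "n \<ge> 2" "p \<in> f2_polys n"
  shows "poly_star n p \<in> f2_polys n"
  using keys_exp_star[OF assms(1)] by (auto simp: f2_polys_def keys_poly_star[OF assms])

lemma poly_star_nonzero:
  assumes "n \<ge> 2" "p \<in> f2_polys n" "p \<noteq> 0"
  shows "poly_star n p \<noteq> 0"
  using keys_poly_star[OF assms(1,2)] assms(3) by (metis image_is_empty keys_eq_empty keys_zero)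

lemma ratvar_power: "ratvar i ^ k = Fract (Poly_Mapping.single (Poly_Mapping.single i k) 1) 1"
proof (induction k)
  case (Suc k)
  then show ?case
    by (simp add: ratvar_def mult_single flip: single_add)
qed (simp add: One_fract_def)

lemma Fract_single_sum:
  "(\<Prod>i\<in>A. Fract (Poly_Mapping.single (h i) (1::bit)) 1) =
     Fract (Poly_Mapping.single (\<Sum>i\<in>A. h i) 1) 1"
  for h :: "'c \<Rightarrow> nat \<Rightarrow>\<^sub>0 nat"
  by (induction A rule: infinite_finite_induct) (auto simp: mult_single One_fract_def)

lemma Fract_sum_1: "(\<Sum>i\<in>A. Fract (p i) 1) = Fract (\<Sum>i\<in>A. p i) (1::'a::idom)"
  by (induction A rule: infinite_finite_induct) (auto simp: Zero_fract_def)

lemma monom_subst_star: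
  assumes "Poly_Mapping.keys e \<subseteq> {..<n}"
  shows "monom_subst (\<lambda>i. if i < n - 1 then ratvar (i + 1) else (ratvar 0)\<^sup>2) e =
    Fract (Poly_Mapping.single (exp_star n e) 1) 1"
proof -
  have "monom_subst (\<lambda>i. if i < n - 1 then ratvar (i + 1) else (ratvar 0)\<^sup>2) e =
    (\<Prod>i<n. Fract (Poly_Mapping.single
      (if i < n - 1 then Poly_Mapping.single (i + 1) (Poly_Mapping.lookup e i)
       else Poly_Mapping.single 0 (2 * Poly_Mapping.lookup e i)) 1) 1)"
    unfolding monom_subst_superset[OF finite_lessThan assms]
    by (rule prod.cong) (simp_all flip: power_mult, simp_all add: ratvar_power)
  then show ?thesis
    by (simp add: Fract_single_sum exp_star_def)
qed

lemma poly_subst_star: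
  assumes "p \<in> f2_polys n"
  shows "poly_subst (\<lambda>i. if i < n - 1 then ratvar (i + 1) else (ratvar 0)\<^sup>2) p =
    Fract (poly_star n p) 1"
proof -
  have "poly_subst (\<lambda>i. if i < n - 1 then ratvar (i + 1) else (ratvar 0)\<^sup>2) p =
    (\<Sum>e\<in>Poly_Mapping.keys p.
      Fract (Poly_Mapping.single (exp_star n e) (Poly_Mapping.lookup p e)) 1)"
    unfolding poly_subst_altdef
  proof (rule sum.cong)
    fix e
    assume "e \<in> Poly_Mapping.keys p"
    then have "Poly_Mapping.keys e \<subseteq> {..<n}"
      using assms by (auto simp: f2_polys_def)
    then show "ratconst (Poly_Mapping.lookup p e) *
        monom_subst (\<lambda>i. if i < n - 1 then ratvar (i + 1) else (ratvar 0)\<^sup>2) e =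
      Fract (Poly_Mapping.single (exp_star n e) (Poly_Mapping.lookup p e)) 1"
      unfolding monom_subst_star[OF \<open>Poly_Mapping.keys e \<subseteq> {..<n}\<close>]
      by (simp add: ratconst_def mult_single)
  qed simp
  then show ?thesis
    by (simp add: Fract_sum_1 poly_star_def)
qed

lemma star_Fract:
  assumes "n \<ge> 2" "p \<in> f2_polys n" "q \<in> f2_polys n" "q \<noteq> 0"
  shows "star n (Fract p q) = Fract (poly_star n p) (poly_star n q)"
proof -
  \<comment> \<open>Injectivity on monomials makes the substituted denominator nonzero, as
    \<open>rat_subst_Fract\<close> demands.\<close>
  have "Fract (poly_star n q) 1 \<noteq> 0"
    using poly_star_nonzero[OF assms(1,3,4)] by (simp add: Zero_fract_def eq_fract)
  then show ?thesis
    unfolding star_def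
    by (subst rat_subst_Fract[OF assms(2,3)]) (simp_all only: poly_subst_star[OF assms(2)]
      poly_subst_star[OF assms(3)] divide_fract mult_1_left mult_1_right not_False_eq_True)
qed

section \<open>Degrees of rational functions\<close>

lemma term_degree_superset:
  assumes "finite A" "Poly_Mapping.keys e \<subseteq> A"
  shows "term_degree n e = (\<Sum>i \<in> A. real (Poly_Mapping.lookup e i) * 2 powr (real i / real n))"
  unfolding term_degree_def
  by (rule sum.mono_neutral_left) (use assms in \<open>auto simp: in_keys_iff\<close>)

lemma term_degree_add: "term_degree n (a + b) = term_degree n a + term_degree n b"
proof -
  let ?A = "Poly_Mapping.keys a \<union> Poly_Mapping.keys b"
  have "finite ?A" "Poly_Mapping.keys (a + b) \<subseteq> ?A"
    by (simp_all add: keys_add)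
  then show ?thesis
    by (simp add: term_degree_superset[of ?A] lookup_add distrib_right sum.distrib)
qed

text \<open>Shifting a variable by one index multiplies its degree by \<open>2 powr (1 / n)\<close>.
  The wrap-around agrees: \<open>x\<^sub>0\<^sup>2\<close> has degree 2, which is
  \<open>2 powr (1 / n)\<close> times the degree of the last variable.\<close>

lemma term_degree_exp_star:
  assumes "n \<ge> 2" and e: "Poly_Mapping.keys e \<subseteq> {..<n}"
  shows "term_degree n (exp_star n e) = 2 powr (1 / real n) * term_degree n e"
proof -
  obtain k where n: "n = Suc k"
    using assms(1) by (cases n) auto
  have shift: "2 powr (real (Suc j) / real n) = 2 powr (1 / real n) * 2 powr (real j / real n)" for j
    by (simp add: add_divide_distrib flip: powr_add)
  have top: "2 powr (1 / real n) * 2 powr (real k / real n) = 2"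
    using shift[of k] by (simp add: n)
  have "term_degree n (exp_star n e) =
      (\<Sum>j<n. real (Poly_Mapping.lookup (exp_star n e) j) * 2 powr (real j / real n))"
    by (rule term_degree_superset) (use keys_exp_star[OF assms(1)] in auto)
  also have "\<dots> = 2 * real (Poly_Mapping.lookup e k) +
      (\<Sum>j<k. real (Poly_Mapping.lookup e j) * 2 powr (real (Suc j) / real n))"
  proof -
    have "{..<n} = {..<Suc k}"
      by (simp add: n)
    then show ?thesis
      using assms(1)
      by (simp only: sum.lessThan_Suc_shift lookup_exp_star[OF assms(1)]) (simp add: n)
  qed
  also have "\<dots> = 2 powr (1 / real n) * 2 powr (real k / real n) * real (Poly_Mapping.lookup e k) +
      2 powr (1 / real n) * (\<Sum>j<k. real (Poly_Mapping.lookup e j) * 2 powr (real j / real n))"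
    unfolding top shift by (simp add: sum_distrib_left mult_ac)
  also have "\<dots> = 2 powr (1 / real n) *
      (\<Sum>j<Suc k. real (Poly_Mapping.lookup e j) * 2 powr (real j / real n))"
    by (simp add: distrib_left mult_ac)
  also have "\<dots> = 2 powr (1 / real n) * term_degree n e"
    using term_degree_superset[of "{..<n}" e n] e by (simp add: n)
  finally show ?thesis .
qed

text \<open>Characteristic two is inherited from the coefficients; this is the source of the parity
  split in \<open>n\<close>.\<close>

lemma of_nat_f2_rat: "(of_nat k :: f2_rat) = (if even k then 0 else 1)"
proof -
  have "(1 + 1 :: f2_rat) = 0"
    using ratconst_add[of 1 1] by simp
  then show ?thesis
    by (induction k) auto
qed

text \<open>The scale \<open>s = 1\<close> gives \<open>dmax\<close> and \<open>s = -1\<close> gives \<open>-dmin\<close>.\<close>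

locale scaled_degree =
  fixes n :: nat and s :: real
  assumes n_ge_2: "n \<ge> 2"
begin

definition t :: real where "t = 2 powr (1 / real n)"

definition w :: "(nat \<Rightarrow>\<^sub>0 nat) \<Rightarrow> real" where "w e = s * term_degree n e"

text \<open>A relational form of the descriptions in \<open>dmax\<close> and \<open>dmin\<close>:
  any one quotient witnesses the degree, and 0 has none.\<close>

definition has_deg :: "f2_rat \<Rightarrow> real \<Rightarrow> bool" where
  "has_deg f d \<longleftrightarrow> (\<exists>p \<in> f2_polys n. \<exists>q \<in> f2_polys n.
     p \<noteq> 0 \<and> q \<noteq> 0 \<and> f = Fract p q \<and> d = wmax w p - wmax w q)"

lemma t_gt_1: "t > 1"
  unfolding t_def using n_ge_2 by simp

lemma t_power_n: "t ^ n = 2"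
proof -
  have "t ^ n = t powr real n"
    using t_gt_1 by (simp add: powr_realpow)
  then show ?thesis
    using n_ge_2 by (simp add: t_def powr_powr)
qed

lemma w_add: "w (a + b) = w a + w b"
  by (simp add: w_def term_degree_add distrib_left)

lemma wmax_w_mult: "p \<noteq> 0 \<Longrightarrow> q \<noteq> 0 \<Longrightarrow> wmax w (p * q) = wmax w p + wmax w q"
  for p q :: f2_poly
  by (rule wmax_mult[OF w_add])

lemma has_degI:
  assumes "p \<in> f2_polys n" "q \<in> f2_polys n" "p \<noteq> 0" "q \<noteq> 0" "f = Fract p q"
    "d = wmax w p - wmax w q"
  shows "has_deg f d"
  using assms unfolding has_deg_def by blast

lemma has_degE:
  assumes "has_deg f d"
  obtains p q where "p \<in> f2_polys n" "q \<in> f2_polys n" "p \<noteq> 0" "q \<noteq> 0" "f = Fract p q"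
    "d = wmax w p - wmax w q"
  using assms unfolding has_deg_def by blast

text \<open>Cross-multiply the two quotients and use that \<open>wmax w\<close> is additive on
  products.\<close>

lemma has_deg_unique:
  assumes "has_deg f d" "has_deg f d'"
  shows "d = d'"
proof -
  obtain p q where pq: "p \<noteq> 0" "q \<noteq> 0" "f = Fract p q" "d = wmax w p - wmax w q"
    using assms(1) by (rule has_degE)
  obtain p' q' where pq': "p' \<noteq> 0" "q' \<noteq> 0" "f = Fract p' q'" "d' = wmax w p' - wmax w q'"
    using assms(2) by (rule has_degE)
  have "p * q' = p' * q"
    using pq pq' by (simp add: eq_fract)
  then have "wmax w p + wmax w q' = wmax w p' + wmax w q"
    using pq pq' by (metis wmax_w_mult)
  then show ?thesis
    using pq pq' by simp
qed

lemma has_deg_nonzero: "has_deg f d \<Longrightarrow> f \<noteq> 0"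
  by (auto simp: has_deg_def Zero_fract_def eq_fract)

lemma has_deg_one: "has_deg 1 0"
  by (rule has_degI[of 1 1]) (simp_all add: f2_polys_one One_fract_def)

lemma has_deg_mult:
  assumes "has_deg f d" "has_deg g e"
  shows "has_deg (f * g) (d + e)"
proof -
  obtain p q where pq: "p \<in> f2_polys n" "q \<in> f2_polys n" "p \<noteq> 0" "q \<noteq> 0" "f = Fract p q"
    "d = wmax w p - wmax w q"
    using assms(1) by (rule has_degE)
  obtain p' q' where pq': "p' \<in> f2_polys n" "q' \<in> f2_polys n" "p' \<noteq> 0" "q' \<noteq> 0" "g = Fract p' q'"
    "e = wmax w p' - wmax w q'"
    using assms(2) by (rule has_degE)
  show ?thesis
    by (rule has_degI[of "p * p'" "q * q'"]) (simp_all add: pq pq' wmax_w_mult f2_polys_mult)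
qed

lemma has_deg_divide:
  assumes "has_deg f d" "has_deg g e"
  shows "has_deg (f / g) (d - e)"
proof -
  obtain p q where pq: "p \<in> f2_polys n" "q \<in> f2_polys n" "p \<noteq> 0" "q \<noteq> 0" "g = Fract p q"
    "e = wmax w p - wmax w q"
    using assms(2) by (rule has_degE)
  have "has_deg (inverse g) (- e)"
    by (rule has_degI[of q p]) (simp_all add: pq)
  then show ?thesis
    using has_deg_mult[OF assms(1)] by (fastforce simp: divide_inverse)
qed

section \<open>Degrees of sums\<close>

definition below :: "f2_rat \<Rightarrow> real \<Rightarrow> bool" where
  "below f d \<longleftrightarrow> f = 0 \<or> (\<exists>e<d. has_deg f e)"

lemma below_zero: "below 0 d"
  by (simp add: below_def)

lemma has_deg_imp_below: "has_deg f e \<Longrightarrow> e < d \<Longrightarrow> below f d"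
  by (auto simp: below_def)

text \<open>Over the common denominator this is the bound for sums of polynomials. Zero counts as
  below everything, so cancellation is harmless.\<close>

lemma below_add:
  assumes "below f d" "below g d"
  shows "below (f + g) d"
proof (cases "f = 0 \<or> g = 0 \<or> f + g = 0")
  case True
  then show ?thesis
    using assms by (auto simp: below_zero)
next
  case False
  then obtain a b where a: "a < d" "has_deg f a" and b: "b < d" "has_deg g b"
    using assms by (auto simp: below_def)
  obtain p q where pq: "p \<in> f2_polys n" "q \<in> f2_polys n" "p \<noteq> 0" "q \<noteq> 0" "f = Fract p q"
    "a = wmax w p - wmax w q"
    using a(2) by (rule has_degE)
  obtain p' q' where pq': "p' \<in> f2_polys n" "q' \<in> f2_polys n" "p' \<noteq> 0" "q' \<noteq> 0" "g = Fract p' q'"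
    "b = wmax w p' - wmax w q'"
    using b(2) by (rule has_degE)
  have fg: "f + g = Fract (p * q' + p' * q) (q * q')"
    using pq pq' by simp
  with False have nz: "p * q' + p' * q \<noteq> 0"
    by (metis fract_collapse(1))
  have "has_deg (f + g) (wmax w (p * q' + p' * q) - wmax w (q * q'))"
    by (rule has_degI[OF _ _ nz _ fg]) (simp_all add: pq pq' f2_polys_add f2_polys_mult)
  \<comment> \<open>Relative to \<open>q * q'\<close> the two products have degrees \<open>a\<close>
    and \<open>b\<close>.\<close>
  moreover have "wmax w (p * q' + p' * q) \<le> max a b + wmax w (q * q')"
    by (rule wmax_add_le[OF nz]) (use pq pq' in \<open>auto simp: wmax_w_mult\<close>)
  ultimately show ?thesis
    using a(1) b(1) by (elim has_deg_imp_below) (simp add: max_def split: if_splits)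
qed

lemma below_sum: "(\<And>i. i \<in> A \<Longrightarrow> below (f i) d) \<Longrightarrow> below (\<Sum>i\<in>A. f i) d"
  by (induction A rule: infinite_finite_induct) (auto simp: below_zero below_add)

text \<open>Over the common denominator the numerator coming from \<open>f\<close> is strictly
  heavier, so \<open>wmax_add_eq\<close> applies.\<close>

lemma has_deg_add_below:
  assumes "has_deg f d" "below g d"
  shows "has_deg (f + g) d"
proof (cases "g = 0")
  case False
  then obtain b where b: "b < d" "has_deg g b"
    using assms by (auto simp: below_def)
  obtain p q where pq: "p \<in> f2_polys n" "q \<in> f2_polys n" "p \<noteq> 0" "q \<noteq> 0" "f = Fract p q"
    "d = wmax w p - wmax w q"
    using assms(1) by (rule has_degE)
  obtain p' q' where pq': "p' \<in> f2_polys n" "q' \<in> f2_polys n" "p' \<noteq> 0" "q' \<noteq> 0" "g = Fract p' q'"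
    "b = wmax w p' - wmax w q'"
    using b(2) by (rule has_degE)
  have "wmax w (p' * q) < wmax w (p * q')" "p * q' \<noteq> 0"
    using pq pq' b(1) by (simp_all add: wmax_w_mult)
  note top = wmax_add_eq[OF this(2) disjI2[OF this(1)]]
  show ?thesis
  proof (rule has_degI[OF _ _ top(1)])
    show "f + g = Fract (p * q' + p' * q) (q * q')"
      using pq pq' by simp
    show "d = wmax w (p * q' + p' * q) - wmax w (q * q')"
      unfolding top(2) using pq pq' by (simp add: wmax_w_mult)
  qed (simp_all add: pq pq' f2_polys_add f2_polys_mult)
qed (use assms in simp)

text \<open>The support is moved by \<open>exp_star n\<close>, which scales every weight by
  \<open>t\<close>; as \<open>t > 0\<close>, the maximum is scaled too.\<close>

lemma wmax_poly_star:
  assumes "p \<in> f2_polys n" "p \<noteq> 0"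
  shows "wmax w (poly_star n p) = t * wmax w p"
proof -
  have scale: "w (exp_star n e) = t * w e" if "e \<in> Poly_Mapping.keys p" for e
    using that assms(1) term_degree_exp_star[OF n_ge_2, of e]
    by (simp add: f2_polys_def w_def t_def)
  obtain e where e: "e \<in> Poly_Mapping.keys p" "w e = wmax w p"
    using assms(2) wmax_attained by blast
  show ?thesis
  proof (rule wmax_eqI)
    show "exp_star n e \<in> Poly_Mapping.keys (poly_star n p)"
      using e keys_poly_star[OF n_ge_2 assms(1)] by simp
    show "w (exp_star n e) = t * wmax w p"
      using e scale by simp
  next
    fix e'
    assume "e' \<in> Poly_Mapping.keys (poly_star n p)"
    then show "w e' \<le> t * wmax w p"
      using keys_poly_star[OF n_ge_2 assms(1)] scale t_gt_1 weight_le_wmax[of _ p w] by auto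
  qed
qed

lemma has_deg_star:
  assumes "has_deg f d"
  shows "has_deg (star n f) (t * d)"
proof -
  obtain p q where pq: "p \<in> f2_polys n" "q \<in> f2_polys n" "p \<noteq> 0" "q \<noteq> 0" "f = Fract p q"
    "d = wmax w p - wmax w q"
    using assms by (rule has_degE)
  show ?thesis
    by (rule has_degI[of "poly_star n p" "poly_star n q"])
      (simp_all add: pq n_ge_2 star_Fract poly_star_in_f2_polys poly_star_nonzero wmax_poly_star
        right_diff_distrib)
qed

lemma has_deg_star_iter: "has_deg f d \<Longrightarrow> has_deg ((star n ^^ i) f) (t ^ i * d)"
  by (induction i) (auto dest: has_deg_star simp: mult.assoc)

lemma has_deg_ratvar_0: "has_deg (ratvar 0) s"
proof (rule has_degI)
  show "ratvar 0 = Fract (Poly_Mapping.single (Poly_Mapping.single 0 1) 1) 1"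
    by (simp add: ratvar_def)
  have "wmax w (Poly_Mapping.single (Poly_Mapping.single 0 1) (1::bit)) = s"
    by (simp add: wmax_single w_def term_degree_def)
  \<comment> \<open>Additivity applied to \<open>1 * 1 = 1\<close> forces weight 0.\<close>
  moreover have "wmax w (1 :: f2_poly) = 0"
    using wmax_w_mult[of 1 1] by simp
  ultimately show "s = wmax w (Poly_Mapping.single (Poly_Mapping.single 0 1) (1::bit)) -
      wmax w (1 :: f2_poly)"
    by simp
  show "Poly_Mapping.single (Poly_Mapping.single 0 1) (1::bit) \<noteq> 0"
    by (metis keys_single keys_zero insert_not_empty zero_neq_one)
qed (use n_ge_2 in \<open>auto intro: f2_polys_one f2_polys_var\<close>)

section \<open>One composition with \<open>Qrat n\<close>\<close>

lemma ratcomp_Qrat: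
  assumes "g \<noteq> 0" "star n g \<noteq> 0"
  shows "ratcomp n (Qrat n) g =
    (g\<^sup>2 + (\<Sum>i = 1..n - 1. (star n ^^ i) g) + of_nat n + 1) / (g * star n g)"
proof -
  define X :: "nat \<Rightarrow> f2_poly" where "X i = Poly_Mapping.single (Poly_Mapping.single i 1) 1" for i
  \<comment> \<open>\<open>P\<close> and \<open>X 0 * X 1\<close> are polynomial numerator and
    denominator of \<open>Qrat n\<close>; at \<open>g\<close> the denominator becomes
    \<open>g * star n g\<close>, nonzero by assumption.\<close>
  define P where "P = X 0 * X 0 + (\<Sum>i = 1..n - 1. X i) + of_nat n + 1"
  have X: "X i \<in> f2_polys n" if "i < n" for i
    using that unfolding X_def by (rule f2_polys_var)
  have XX: "X 0 * X 1 \<in> f2_polys n"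
    using X n_ge_2 by (intro f2_polys_mult) auto
  have P: "P \<in> f2_polys n"
    unfolding P_def using X n_ge_2
    by (intro f2_polys_add f2_polys_mult f2_polys_sum f2_polys_of_nat f2_polys_one) auto
  have rv: "ratvar i = Fract (X i) 1" for i
    by (simp add: ratvar_def X_def)
  have "Qrat n = Fract P (X 0 * X 1)"
    unfolding Qrat_def rv P_def
    by (simp add: power2_eq_square Fract_sum_1 of_nat_fract One_fract_def del: mult_fract_cancel)
  moreover have sX: "poly_subst a (X i) = a i" for a i
    by (simp add: X_def poly_subst_single monom_subst_def)
  moreover have "poly_subst a P = a 0 * a 0 + (\<Sum>i = 1..n - 1. a i) + of_nat n + 1" for a
    by (simp add: P_def poly_subst_add poly_subst_mult poly_subst_sum poly_subst_of_nat sX)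
  moreover have "poly_subst a (X 0 * X 1) = a 0 * a 1" for a
    by (simp add: poly_subst_mult sX)
  ultimately show ?thesis
    unfolding ratcomp_def using assms
    by (subst \<open>Qrat n = _\<close>, subst rat_subst_Fract[OF P XX]) (simp_all add: power2_eq_square)
qed

text \<open>The denominator always contributes \<open>D + t * D\<close>, so each case only has to
  find the degree \<open>N\<close> of the numerator.\<close>

lemma has_deg_ratcomp:
  assumes "has_deg g D"
    and "has_deg (g\<^sup>2 + (\<Sum>i = 1..n - 1. (star n ^^ i) g) + of_nat n + 1) N"
  shows "has_deg (ratcomp n (Qrat n) g) (N - (D + t * D))"
  using has_deg_divide[OF assms(2) has_deg_mult[OF assms(1) has_deg_star[OF assms(1)]]]
    has_deg_nonzero[OF assms(1)] has_deg_nonzero[OF has_deg_star[OF assms(1)]]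
  by (simp add: ratcomp_Qrat)

lemma has_deg_square: "has_deg g D \<Longrightarrow> has_deg (g\<^sup>2) (2 * D)"
  using has_deg_mult[of g D g D] by (simp add: power2_eq_square)

lemma step_pos:
  assumes "has_deg g D" "D > 0"
  shows "has_deg (ratcomp n (Qrat n) g) ((1 - t) * D)"
proof -
  have "below (\<Sum>i = 1..n - 1. (star n ^^ i) g) (2 * D)"
  proof (rule below_sum, rule has_deg_imp_below[OF has_deg_star_iter[OF assms(1)]])
    fix i
    assume "i \<in> {1..n - 1}"
    \<comment> \<open>Here \<open>i < n\<close>, and \<open>2 * D = t ^ n * D\<close> is the degree
      of \<open>g\<^sup>2\<close>.\<close>
    then have "t ^ i < t ^ n"
      using t_gt_1 by (intro power_strict_increasing) auto
    then show "t ^ i * D < 2 * D"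
      using assms(2) by (simp add: t_power_n)
  qed
  \<comment> \<open>The constant is 0 or 1, and degree 0 is below \<open>2 * D\<close>.\<close>
  moreover have "below (of_nat n + 1) (2 * D)"
    using has_deg_imp_below[OF has_deg_one] assms(2) of_nat_f2_rat[of n] of_nat_f2_rat[of "Suc n"]
    by (auto simp: below_zero split: if_splits)
  ultimately have "below ((\<Sum>i = 1..n - 1. (star n ^^ i) g) + (of_nat n + 1)) (2 * D)"
    by (rule below_add)
  then have "has_deg (g\<^sup>2 + (\<Sum>i = 1..n - 1. (star n ^^ i) g) + of_nat n + 1) (2 * D)"
    using has_deg_add_below[OF has_deg_square[OF assms(1)]] by (simp add: add.assoc)
  from has_deg_ratcomp[OF assms(1) this] show ?thesis
    by (simp add: algebra_simps)
qed

text \<open>A negative \<open>D\<close> reverses the order, so the smallest power of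
  \<open>t\<close> wins: \<open>N = t * D\<close>, coming from \<open>star n g\<close>.\<close>

lemma step_neg_odd:
  assumes "has_deg g D" "D < 0" "odd n"
  shows "has_deg (ratcomp n (Qrat n) g) (- D)"
proof -
  have "below (\<Sum>i = Suc 1..n - 1. (star n ^^ i) g) (t * D)"
  proof (rule below_sum, rule has_deg_imp_below[OF has_deg_star_iter[OF assms(1)]])
    fix i
    assume "i \<in> {Suc 1..n - 1}"
    then have "t ^ 1 < t ^ i"
      using t_gt_1 by (intro power_strict_increasing) auto
    then show "t ^ i * D < t * D"
      using assms(2) by simp
  qed
  moreover have "below (g\<^sup>2) (t * D)"
  proof (rule has_deg_imp_below[OF has_deg_square[OF assms(1)]])
    have "t ^ 1 < t ^ n"
      using t_gt_1 n_ge_2 by (intro power_strict_increasing) auto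
    then show "2 * D < t * D"
      using assms(2) by (simp add: t_power_n)
  qed
  ultimately have "below ((\<Sum>i = Suc 1..n - 1. (star n ^^ i) g) + g\<^sup>2) (t * D)"
    by (rule below_add)
  then have "has_deg (star n g + ((\<Sum>i = Suc 1..n - 1. (star n ^^ i) g) + g\<^sup>2)) (t * D)"
    by (rule has_deg_add_below[OF has_deg_star[OF assms(1)]])
  moreover have "(\<Sum>i = 1..n - 1. (star n ^^ i) g) =
      star n g + (\<Sum>i = Suc 1..n - 1. (star n ^^ i) g)"
    using n_ge_2 by (subst sum.atLeast_Suc_atMost) auto
  \<comment> \<open>\<open>n + 1\<close> is even, hence zero here.\<close>
  moreover have absorb: "x + of_nat n + 1 = x" for x :: f2_rat
    using of_nat_f2_rat[of "Suc n"] assms(3) by (simp add: add.assoc add.commute[of "of_nat n"])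
  ultimately have "has_deg (g\<^sup>2 + (\<Sum>i = 1..n - 1. (star n ^^ i) g) + of_nat n + 1) (t * D)"
    unfolding absorb by (simp only: add_ac)
  then show ?thesis
    using has_deg_ratcomp[OF assms(1)] by fastforce
qed

text \<open>All other summands have negative degree, while \<open>n + 1\<close> equals 1 and has
  degree 0, so \<open>N = 0\<close>.\<close>

lemma step_neg_even:
  assumes "has_deg g D" "D < 0" "even n"
  shows "has_deg (ratcomp n (Qrat n) g) (- (1 + t) * D)"
proof -
  have "below (\<Sum>i = 1..n - 1. (star n ^^ i) g) 0"
    using assms(2) t_gt_1
    by (intro below_sum has_deg_imp_below[OF has_deg_star_iter[OF assms(1)]])
      (simp add: mult_pos_neg)
  moreover have "below (g\<^sup>2) 0"
    using assms(2) by (intro has_deg_imp_below[OF has_deg_square[OF assms(1)]]) simp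
  ultimately have "below (g\<^sup>2 + (\<Sum>i = 1..n - 1. (star n ^^ i) g)) 0"
    by (intro below_add)
  then have "has_deg (1 + (g\<^sup>2 + (\<Sum>i = 1..n - 1. (star n ^^ i) g))) 0"
    by (rule has_deg_add_below[OF has_deg_one])
  then have "has_deg (g\<^sup>2 + (\<Sum>i = 1..n - 1. (star n ^^ i) g) + of_nat n + 1) 0"
    using assms(3) by (simp add: of_nat_f2_rat add_ac)
  from has_deg_ratcomp[OF assms(1) this] show ?thesis
    by (simp add: algebra_simps)
qed

text \<open>A positive and a negative step follow each other in either order, so the degree after two
  steps does not depend on the initial sign.\<close>

lemma two_steps:
  assumes "has_deg g D" "D \<noteq> 0"
  shows "has_deg (ratcomp n (Qrat n) (ratcomp n (Qrat n) g))
    ((if odd n then t - 1 else t\<^sup>2 - 1) * D)"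
proof (cases "D > 0")
  case True
  \<comment> \<open>Since \<open>t > 1\<close> the sign flips, so the second step is a negative one
    and contributes the factor \<open>- 1\<close> or \<open>- (1 + t)\<close>.\<close>
  have neg: "(1 - t) * D < 0"
    using True t_gt_1 by (simp add: mult_neg_pos)
  note step = step_pos[OF assms(1) True]
  show ?thesis
    using step_neg_odd[OF step neg] step_neg_even[OF step neg]
    by (cases "odd n") (simp_all add: algebra_simps power2_eq_square)
next
  case False
  then have neg: "D < 0"
    using assms(2) by simp
  have pos: "- D > 0" "- (1 + t) * D > 0"
    using neg t_gt_1 by (simp_all add: mult_neg_neg)
  show ?thesis
    using step_pos[OF step_neg_odd[OF assms(1) neg] pos(1)]
      step_pos[OF step_neg_even[OF assms(1) neg] pos(2)]
    by (cases "odd n") (simp_all add: algebra_simps power2_eq_square)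
qed

section \<open>Degrees of the iterates\<close>

definition c :: real where "c = (if odd n then t - 1 else t\<^sup>2 - 1)"

text \<open>Positivity gives every even iterate a degree of the same sign as \<open>s\<close>, which
  decides the kind of the next step.\<close>

lemma c_pos: "c > 0"
  using t_gt_1 by (simp add: c_def one_less_power)

lemma Qiter_Suc: "Qiter n (Suc m) = ratcomp n (Qrat n) (Qiter n m)"
  by (simp add: Qiter_def)

lemma has_deg_Qiter_even:
  assumes "s \<noteq> 0"
  shows "has_deg (Qiter n (2 * k)) (c ^ k * s)"
proof (induction k)
  case 0
  then show ?case
    by (simp add: Qiter_def has_deg_ratvar_0)
next
  case (Suc k)
  have "c ^ k * s \<noteq> 0"
    using assms c_pos by simp
  from two_steps[OF Suc this] show ?case
    by (simp add: Qiter_Suc mult.assoc flip: c_def)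
qed

lemma has_deg_Qiter_odd:
  assumes "s \<noteq> 0"
  shows "has_deg (Qiter n (2 * k + 1))
    ((if s > 0 then 1 - t else if odd n then - 1 else - (1 + t)) * (c ^ k * s))"
proof (cases "s > 0")
  case True
  then have "c ^ k * s > 0"
    using c_pos by simp
  from step_pos[OF has_deg_Qiter_even[OF assms] this] True show ?thesis
    by (simp add: Qiter_Suc)
next
  case False
  then have "c ^ k * s < 0"
    using c_pos assms by (simp add: mult_pos_neg)
  note step_neg_odd[OF has_deg_Qiter_even[OF assms] this]
    step_neg_even[OF has_deg_Qiter_even[OF assms] this]
  with False show ?thesis
    by (cases "odd n") (simp_all add: Qiter_Suc)
qed

end

section \<open>Return to \<open>dmax\<close> and \<open>dmin\<close>\<close>

lemma dmax_eqI:
  assumes "n \<ge> 2" "scaled_degree.has_deg n 1 f d"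
  shows "dmax n f = d"
proof -
  interpret scaled_degree n 1
    by unfold_locales (fact assms(1))
  have "poly_dmax n p = wmax w p" for p
    by (simp add: poly_dmax_def wmax_def w_def[abs_def])
  \<comment> \<open>For \<open>s = 1\<close> the relation under the description is
    \<open>has_deg\<close> itself, so uniqueness settles the value.\<close>
  then have "dmax n f = (THE d. has_deg f d)"
    by (simp add: dmax_def has_deg_def)
  then show ?thesis
    using assms(2) has_deg_unique by (simp add: the_equality)
qed

lemma dmin_eqI:
  assumes "n \<ge> 2" "scaled_degree.has_deg n (- 1) f (- d)"
  shows "dmin n f = d"
proof -
  interpret scaled_degree n "- 1"
    by unfold_locales (fact assms(1))
  have "poly_dmin n p = - wmax w p" if "p \<noteq> 0" for p
  proof -
    have "wmax w p = Max (uminus ` term_degree n ` Poly_Mapping.keys p)"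
      by (simp add: wmax_def w_def[abs_def] image_image)
    \<comment> \<open>Negation turns the maximum into a minimum; \<open>p \<noteq> 0\<close> makes
      the set of degrees nonempty.\<close>
    also have "\<dots> = - Min (term_degree n ` Poly_Mapping.keys p)"
      using that by (subst minus_Min_eq_Max) auto
    finally show ?thesis
      by (simp add: poly_dmin_def)
  qed
  then have "dmin n f = (THE d. has_deg f (- d))"
    unfolding dmin_def has_deg_def by (intro arg_cong[where f = The] ext bex_cong) auto
  also have "\<dots> = d"
    using assms(2) has_deg_unique by (intro the_equality) (simp, fastforce)
  finally show ?thesis .
qed

theorem theorem3p2:
  fixes n :: nat
  assumes "n \<ge> 2"
  shows "(n \<ge> 3 \<and> odd n \<longrightarrow>
           (\<forall>m :: nat.
              dmax n (Qiter n m) =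
                (-1) ^ m * (-1 + 2 powr (1 / real n)) ^ nat \<lceil>real m / 2\<rceil> \<and>
              dmin n (Qiter n m) =
                (-1) ^ m * (-1 + 2 powr (1 / real n)) ^ nat \<lfloor>real m / 2\<rfloor>)) \<and>
         (n \<ge> 2 \<and> even n \<longrightarrow>
           (\<forall>m :: nat.
              dmax n (Qiter n m) =
                (-1) ^ m * (-1 + 2 powr (2 / real n)) ^ nat \<lfloor>real m / 2\<rfloor>
                  * (-1 + 2 powr (1 / real n)) ^ (m - 2 * nat \<lfloor>real m / 2\<rfloor>) \<and>
              dmin n (Qiter n m) =
                (-1) ^ m * (-1 + 2 powr (2 / real n)) ^ nat \<lfloor>real m / 2\<rfloor>
                  * (1 + 2 powr (1 / real n)) ^ (m - 2 * nat \<lfloor>real m / 2\<rfloor>)))"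
proof -
  interpret mx: scaled_degree n 1
    by unfold_locales (fact assms)
  interpret mn: scaled_degree n "- 1"
    by unfold_locales (fact assms)
  define t where "t = 2 powr (1 / real n)"
  define c where "c = (if odd n then t - 1 else t\<^sup>2 - 1)"
  have t: "mx.t = t" "mn.t = t" and c: "mx.c = c" "mn.c = c"
    by (simp_all add: t_def c_def mx.t_def mn.t_def mx.c_def mn.c_def)
  have t2: "2 powr (2 / real n) = t\<^sup>2"
    by (simp add: t_def powr_power)
  have max_even: "dmax n (Qiter n (2 * k)) = c ^ k" for k
    using dmax_eqI[OF assms mx.has_deg_Qiter_even[of k]] by (simp add: c)
  \<comment> \<open>For \<open>s = - 1\<close> the degree is \<open>- (c ^ k)\<close>, the negative
    of \<open>dmin\<close>.\<close>
  have min_even: "dmin n (Qiter n (2 * k)) = c ^ k" for k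
    using dmin_eqI[OF assms, of "Qiter n (2 * k)" "c ^ k"] mn.has_deg_Qiter_even[of k]
    by (simp add: c)
  have max_odd: "dmax n (Qiter n (2 * k + 1)) = (1 - t) * c ^ k" for k
    using dmax_eqI[OF assms mx.has_deg_Qiter_odd[of k]] by (simp add: c t)
  have min_odd: "dmin n (Qiter n (2 * k + 1)) = - (if odd n then 1 else 1 + t) * c ^ k" for k
    using dmin_eqI[OF assms, of "Qiter n (2 * k + 1)" "- (if odd n then 1 else 1 + t) * c ^ k"]
      mn.has_deg_Qiter_odd[of k]
    by (cases "odd n") (simp_all add: c t)
  \<comment> \<open>Floor and ceiling differ only for \<open>m = 2 * k + 1\<close>. For odd
    \<open>n\<close> the ceiling \<open>k + 1\<close> absorbs the extra factor in
    \<open>(1 - t) * c ^ k = - ((t - 1) ^ (k + 1))\<close>.\<close>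
  have rounding: "nat \<lfloor>real (2 * k) / 2\<rfloor> = k" "nat \<lceil>real (2 * k) / 2\<rceil> = k"
    "nat \<lfloor>real (2 * k + 1) / 2\<rfloor> = k" "nat \<lceil>real (2 * k + 1) / 2\<rceil> = k + 1" for k
  proof -
    have "\<lfloor>real (2 * k + 1) / 2\<rfloor> = int k" "\<lceil>real (2 * k + 1) / 2\<rceil> = int (k + 1)"
      by (rule floor_unique ceiling_unique; simp)+
    then show "nat \<lfloor>real (2 * k + 1) / 2\<rfloor> = k" "nat \<lceil>real (2 * k + 1) / 2\<rceil> = k + 1"
      by simp_all
  qed simp_all
  show ?thesis
    unfolding t2 t_def[symmetric]
  proof (intro conjI impI allI)
    fix m :: nat
    assume "n \<ge> 3 \<and> odd n"
    then have c': "c = - 1 + t"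
      by (simp add: c_def)
    consider k where "m = 2 * k" | k where "m = 2 * k + 1"
      by (meson evenE oddE)
    then show "dmax n (Qiter n m) = (-1) ^ m * (-1 + t) ^ nat \<lceil>real m / 2\<rceil>"
      by cases (simp_all only: max_even max_odd rounding c', simp_all add: algebra_simps)
  next
    fix m :: nat
    assume odd: "n \<ge> 3 \<and> odd n"
    then have c': "c = - 1 + t"
      by (simp add: c_def)
    consider k where "m = 2 * k" | k where "m = 2 * k + 1"
      by (meson evenE oddE)
    then show "dmin n (Qiter n m) = (-1) ^ m * (-1 + t) ^ nat \<lfloor>real m / 2\<rfloor>"
      by cases (simp_all only: min_even min_odd rounding c', simp_all add: odd)
  next
    fix m :: nat
    assume "n \<ge> 2 \<and> even n"
    then have c': "c = - 1 + t\<^sup>2"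
      by (simp add: c_def)
    consider k where "m = 2 * k" | k where "m = 2 * k + 1"
      by (meson evenE oddE)
    then show "dmax n (Qiter n m) = (-1) ^ m * (-1 + t\<^sup>2) ^ nat \<lfloor>real m / 2\<rfloor>
        * (-1 + t) ^ (m - 2 * nat \<lfloor>real m / 2\<rfloor>)"
      by cases (simp_all only: max_even max_odd rounding c', simp_all add: algebra_simps)
  next
    fix m :: nat
    assume even: "n \<ge> 2 \<and> even n"
    then have c': "c = - 1 + t\<^sup>2"
      by (simp add: c_def)
    consider k where "m = 2 * k" | k where "m = 2 * k + 1"
      by (meson evenE oddE)
    then show "dmin n (Qiter n m) = (-1) ^ m * (-1 + t\<^sup>2) ^ nat \<lfloor>real m / 2\<rfloor>
        * (1 + t) ^ (m - 2 * nat \<lfloor>real m / 2\<rfloor>)"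
      by cases (simp_all only: min_even min_odd rounding c', simp_all add: even algebra_simps)
  qed
qed

end
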